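(* The convex constraints $$\beta_j+\alpha_j^\intercal\hat\mu_k(v)+\tau_{jk}\sqrt{\alpha_j^\intercal\hat\Sigma_k(L)\alpha_j}+\varepsilon\,(1+\tau_{jk}^2)^{1/2}\,\sigma_{\max}^2(\tilde L_k)\,\|\alpha_j\|\le0,\qquad\forall j\in\{0,\dots,J\},\ \forall k\in\{0,\dots,N\},$$ in $(v,L)$ are equivalent to the following constraints in the decision variables $\{v,L,\rho_k\}$ (that is, $(v,L)$ satisfies the former if and only if there exist real numbers $\rho_0,\dots,\rho_N$ such that $(v,L,\rho_0,\dots,\rho_N)$ satisfies the latter): $$\beta_j+\alpha_j^\intercal\hat\mu_k(v)+\tau_{jk}\big\|\Sigma_w^{1/2}\mathcal D^\intercal(I+\mathcal B L)^\intercal E_k^\intercal\alpha_j\big\|+\varepsilon\,\rho_k\,\|\alpha_j\|\sqrt{1+\tau_{jk}^2}\le0,\qquad\forall j,\ \forall k,$$ $$\begin{bmatrix} I & E_k(I+\mathcal B L)\mathcal D\\ \mathcal D^\intercal(I+\mathcal B L)^\intercal E_k^\intercal & \rho_k I\end{bmatrix}\succeq0,\qquad\forall k.$$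
   Context: $\|\cdot\|$ is the Euclidean norm and $\sigma_{\max}$ the largest singular value. $N,n,m,d$ are positive integers, $A\in\mathbb R^{n\times n}$, $B\in\mathbb R^{n\times m}$, $D\in\mathbb R^{n\times d}$, $x_0\in\mathbb R^n$. $\mathcal A$ has block rows $A^k$ ($k=0,\dots,N$); $\mathcal B\in\mathbb R^{(N+1)n\times Nm}$ and $\mathcal D\in\mathbb R^{(N+1)n\times Nd}$ have $(k,i)$ block ($k=0,\dots,N$, $i=0,\dots,N-1$) equal to $A^{k-1-i}B$, respectively $A^{k-1-i}D$, if $i<k$ and $0$ otherwise. $E_k\in\mathbb R^{n\times(N+1)n}$ extracts the $k$-th block of size $n$. The variables are $v\in\mathbb R^{Nm}$ and $L\in\mathbb R^{Nm\times(N+1)n}$ of the form $L=K(I-\mathcal B K)^{-1}$ with $K$ a block lower-triangular stacked feedback gain. $\Sigma_w\in\mathbb R^{Nd\times Nd}$, $\Sigma_w\succ0$, $\varepsilon>0$, $\alpha_j\in\mathbb R^n$, $\beta_j\in\mathbb R$, $\gamma_{jk}\in(0,1)$, and $\tau_{jk}=\sqrt{(1-\gamma_{jk})/\gamma_{jk}}$. Definitions: $\tilde L_k=E_k(I+\mathcal B L)\mathcal D$, $\hat\mu_k(v)=E_k(\mathcal A x_0+\mathcal B v)$, $\hat\Sigma_k(L)=\tilde L_k\Sigma_w\tilde L_k^\intercal$. *)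

theory Defs
  imports
    Complex_Main
    "Jordan_Normal_Form.Matrix"
    "Jordan_Normal_Form.Gauss_Jordan_Elimination"
    "Jordan_Normal_Form.Char_Poly"
begin

definition vec_norm2 :: "real vec \<Rightarrow> real" where
  "vec_norm2 x = sqrt (x \<bullet> x)"

(* transpose_mat M = M forces M to be square *)
definition pos_semidef :: "real mat \<Rightarrow> bool" where
  "pos_semidef M \<longleftrightarrow> transpose_mat M = M \<and>
     (\<forall>x \<in> carrier_vec (dim_row M). 0 \<le> x \<bullet> (M *\<^sub>v x))"

definition pos_def :: "real mat \<Rightarrow> bool" where
  "pos_def M \<longleftrightarrow> transpose_mat M = M \<and>
     (\<forall>x \<in> carrier_vec (dim_row M). x \<noteq> 0\<^sub>v (dim_row M) \<longrightarrow> 0 < x \<bullet> (M *\<^sub>v x))"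

(* The principal square root: every positive semidefinite M has exactly one
   positive semidefinite R with R * R = M. *)
definition mat_sqrt :: "real mat \<Rightarrow> real mat" where
  "mat_sqrt M = (THE R. pos_semidef R \<and> R * R = M)"

(* The singular values of M are the square roots of the eigenvalues of M\<^sup>T M.
   (When M has more columns than rows this set also contains 0, which does
   not affect the maximum.) *)
definition sigma_max :: "real mat \<Rightarrow> real" where
  "sigma_max M = Max {sqrt l | l. eigenvalue (transpose_mat M * M) l}"

(* The block rows A^k, k = 0..N; row r of the stack is row r mod n of block r div n. *)
definition stacked_A :: "nat \<Rightarrow> nat \<Rightarrow> real mat \<Rightarrow> real mat" where
  "stacked_A N n A = mat ((N + 1) * n) n (\<lambda>(r, c). (A ^\<^sub>m (r div n)) $$ (r mod n, c))"

(* For G of size n x p: the (N+1)n x Np matrix whose (k,i) block is A^(k-1-i) G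
   if i < k, and 0 otherwise. *)
definition stacked_input :: "nat \<Rightarrow> nat \<Rightarrow> nat \<Rightarrow> real mat \<Rightarrow> real mat \<Rightarrow> real mat" where
  "stacked_input N n p A G = mat ((N + 1) * n) (N * p)
     (\<lambda>(r, c). if c div p < r div n
        then (A ^\<^sub>m (r div n - 1 - c div p) * G) $$ (r mod n, c mod p) else 0)"

definition block_extract :: "nat \<Rightarrow> nat \<Rightarrow> nat \<Rightarrow> real mat" where
  "block_extract N n k = mat n ((N + 1) * n) (\<lambda>(r, c). if c = k * n + r then 1 else 0)"

(* Stacked gains: an N x (N+1) array of m x n blocks whose (i,k) block vanishes for i < k,
   i.e. the input at time i only depends on the states at times 0..i. *)
definition feedback_gains :: "nat \<Rightarrow> nat \<Rightarrow> nat \<Rightarrow> real mat set" where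
  "feedback_gains N n m = {K \<in> carrier_mat (N * m) ((N + 1) * n).
     \<forall>r < N * m. \<forall>c < (N + 1) * n. r div m < c div n \<longrightarrow> K $$ (r, c) = 0}"

(* All L = K (I - BB K)^(-1), where BB is the stacked input matrix. The matrix BB K is
   strictly block lower triangular, so the inverse exists for every gain K. *)
definition admissible_L :: "nat \<Rightarrow> nat \<Rightarrow> nat \<Rightarrow> real mat \<Rightarrow> real mat \<Rightarrow> real mat set" where
  "admissible_L N n m A B = {K * M | K M. K \<in> feedback_gains N n m \<and>
     mat_inverse (1\<^sub>m ((N + 1) * n) - stacked_input N n m A B * K) = Some M}"

definition L_tilde ::
  "nat \<Rightarrow> nat \<Rightarrow> nat \<Rightarrow> nat \<Rightarrow> real mat \<Rightarrow> real mat \<Rightarrow> real mat \<Rightarrow> real mat \<Rightarrow> nat \<Rightarrow> real mat" where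
  "L_tilde N n m d A B D L k =
     block_extract N n k * (1\<^sub>m ((N + 1) * n) + stacked_input N n m A B * L)
       * stacked_input N n d A D"

definition mu_hat ::
  "nat \<Rightarrow> nat \<Rightarrow> nat \<Rightarrow> real mat \<Rightarrow> real mat \<Rightarrow> real vec \<Rightarrow> real vec \<Rightarrow> nat \<Rightarrow> real vec" where
  "mu_hat N n m A B x0 v k =
     block_extract N n k *\<^sub>v (stacked_A N n A *\<^sub>v x0 + stacked_input N n m A B *\<^sub>v v)"

definition Sigma_hat ::
  "nat \<Rightarrow> nat \<Rightarrow> nat \<Rightarrow> nat \<Rightarrow> real mat \<Rightarrow> real mat \<Rightarrow> real mat \<Rightarrow> real mat \<Rightarrow> real mat \<Rightarrow> nat \<Rightarrow> real mat"
  where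
  "Sigma_hat N n m d A B D \<Sigma>w L k =
     L_tilde N n m d A B D L k * \<Sigma>w * transpose_mat (L_tilde N n m d A B D L k)"

definition tau :: "real \<Rightarrow> real" where
  "tau g = sqrt ((1 - g) / g)"

end

theory Submission
  imports Defs "HOL-Analysis.Function_Topology"
begin

text \<open>
  Fix \<open>k\<close> and write \<open>M\<close> for the matrix \<open>E\<^sub>k (I + \<B> L) \<D>\<close>.
  The two families of constraints differ in two places, and each is settled by a fact about a
  single matrix.

  The square-root terms agree identically: \<open>\<alpha>\<^sup>T M \<Sigma>\<^sub>w M\<^sup>T \<alpha>\<close> is the squared norm of
  \<open>\<Sigma>\<^sub>w\<^sup>1\<^sup>/\<^sup>2 M\<^sup>T \<alpha>\<close>, because \<open>\<Sigma>\<^sub>w\<^sup>1\<^sup>/\<^sup>2\<close> is symmetric and squares to \<open>\<Sigma>\<^sub>w\<close>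
  (\<open>norm_mat_sqrt_mult\<close>).

  The block matrix inequality says exactly \<open>\<sigma>\<^sub>m\<^sub>a\<^sub>x(M)\<^sup>2 \<le> \<rho>\<^sub>k\<close>. By completing the square it is
  equivalent to \<open>\<parallel>M y\<parallel>\<^sup>2 \<le> \<rho>\<^sub>k \<parallel>y\<parallel>\<^sup>2\<close> for all \<open>y\<close> (\<open>schur_complement_identity_block\<close>), and
  the least such \<open>\<rho>\<^sub>k\<close> is the largest eigenvalue of \<open>M\<^sup>T M\<close> (\<open>sigma_max_square_le_iff\<close>).

  Hence \<open>\<rho>\<^sub>k = \<sigma>\<^sub>m\<^sub>a\<^sub>x(M)\<^sup>2\<close> turns a solution of the first system into one of the second.
  Conversely any feasible \<open>\<rho>\<^sub>k\<close> dominates \<open>\<sigma>\<^sub>m\<^sub>a\<^sub>x(M)\<^sup>2\<close>, and the left-hand sides are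
  nondecreasing in that quantity since its coefficient
  \<open>\<epsilon> \<parallel>\<alpha>\<^sub>j\<parallel> (1 + \<tau>\<^sub>j\<^sub>k\<^sup>2)\<^sup>1\<^sup>/\<^sup>2\<close> is nonnegative.

  Both facts rest on the spectral theorem for real symmetric matrices
  (\<open>real_spectral_theorem\<close>), which yields the existence and uniqueness of the principal square
  root and the bound of a quadratic form by the largest eigenvalue. The spectral theorem is
  obtained variationally: a maximizer of the quadratic form on the unit sphere of the orthogonal
  complement of the eigenvectors found so far is a further eigenvector.
\<close>

section \<open>Maximizing a quadratic form on a sphere\<close>

lemma symmetric_mat_adjoint:
  fixes S :: "real mat"
  assumes "S \<in> carrier_mat q q" "transpose_mat S = S"
    and "x \<in> carrier_vec q" "y \<in> carrier_vec q"
  shows "x \<bullet> (S *\<^sub>v y) = (S *\<^sub>v x) \<bullet> y"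
  using transpose_vec_mult_scalar[OF assms(1,4,3)] assms(2) by simp

lemma scalar_prod_self_pos:
  fixes x :: "real vec"
  assumes "x \<in> carrier_vec q" "x \<noteq> 0\<^sub>v q"
  shows "0 < x \<bullet> x"
proof -
  obtain i where i: "i < q" "x $ i \<noteq> 0"
    using assms by (metis carrier_vecD eq_vecI index_zero_vec(1,2))
  have "0 < (\<Sum>j = 0..<q. x $ j * x $ j)"
    using i by (intro sum_pos2[of _ i]) (auto simp: zero_less_mult_iff)
  with assms(1) show ?thesis by (simp add: scalar_prod_def)
qed

lemma scalar_prod_self_nonneg: "0 \<le> x \<bullet> (x :: real vec)"
  by (simp add: scalar_prod_def sum_nonneg)

text \<open>
  The constraint set is compact. Vectors are identified with functions on \<open>\<nat>\<close> that vanish from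
  index \<open>q\<close> on, so that compactness of a box in the product topology (Tychonoff) applies; the unit
  sphere and the orthogonality conditions cut out closed subsets.
\<close>

lemma quadratic_form_attains_max:
  fixes S :: "real mat"
  assumes S: "S \<in> carrier_mat q q"
    and W: "W \<subseteq> carrier_vec q"
    and x0: "x0 \<in> carrier_vec q" "x0 \<bullet> x0 = 1" "\<forall>w\<in>W. w \<bullet> x0 = 0"
  obtains x where "x \<in> carrier_vec q" "x \<bullet> x = 1" "\<forall>w\<in>W. w \<bullet> x = 0"
    "\<And>y. \<lbrakk>y \<in> carrier_vec q; y \<bullet> y = 1; \<forall>w\<in>W. w \<bullet> y = 0\<rbrakk> \<Longrightarrow> y \<bullet> (S *\<^sub>v y) \<le> x \<bullet> (S *\<^sub>v x)"
proof -
  define box :: "(nat \<Rightarrow> real) set" where "box = Pi\<^sub>E UNIV (\<lambda>i. if i < q then {-1..1} else {0})"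
  define unit :: "(nat \<Rightarrow> real) set" where "unit = {f. vec q f \<bullet> vec q f = 1}"
  define perp :: "(nat \<Rightarrow> real) set" where "perp = (\<Inter>w\<in>W. {f. w \<bullet> vec q f = 0})"
  have cont [continuous_intros]: "continuous_on UNIV (\<lambda>f. f i)" for i :: nat
    by simp
  have prod: "w \<bullet> vec q f = (\<Sum>i<q. w $ i * f i)" for w :: "real vec" and f
    by (simp add: scalar_prod_def atLeast0LessThan)
  have form: "vec q f \<bullet> (S *\<^sub>v vec q f) = (\<Sum>i<q. f i * (\<Sum>j<q. S $$ (i,j) * f j))" for f
    using S by (auto simp: scalar_prod_def atLeast0LessThan intro!: sum.cong)
  have "compactin (product_topology (\<lambda>i. euclidean) UNIV) box"
    unfolding box_def compactin_PiE by auto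
  then have "compact box"
    by (simp add: euclidean_product_topology)
  moreover have "closed unit"
    unfolding unit_def prod by (intro closed_Collect_eq continuous_intros) auto
  moreover have "closed perp"
    unfolding perp_def prod by (intro closed_INT ballI closed_Collect_eq continuous_intros)
  ultimately have K: "compact (box \<inter> unit \<inter> perp)"
    by (simp add: compact_Int_closed)
  have entry_le: "\<bar>y $ i\<bar> \<le> 1" if "y \<in> carrier_vec q" "y \<bullet> y = 1" "i < q" for y :: "real vec" and i
  proof -
    have "y $ i * y $ i \<le> (\<Sum>j = 0..<q. y $ j * y $ j)"
      using that(3) by (intro member_le_sum) auto
    with that show ?thesis
      by (simp add: scalar_prod_def abs_square_le_1 flip: power2_eq_square)
  qed
  define coords where "coords y = (\<lambda>i. if i < q then y $ i else 0)" for y :: "real vec"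
  have vec_coords: "vec q (coords y) = y" if "y \<in> carrier_vec q" for y
    using that by (auto simp: coords_def)
  have coords_mem: "coords y \<in> box \<inter> unit \<inter> perp"
    if "y \<in> carrier_vec q" "y \<bullet> y = 1" "\<forall>w\<in>W. w \<bullet> y = 0" for y
  proof -
    have "coords y \<in> box"
      using entry_le[OF that(1,2)] by (auto simp: box_def coords_def abs_le_iff)
    then show ?thesis
      using that vec_coords[OF that(1)] by (simp add: unit_def perp_def)
  qed
  have "continuous_on (box \<inter> unit \<inter> perp) (\<lambda>f. vec q f \<bullet> (S *\<^sub>v vec q f))"
    unfolding form by (rule continuous_on_subset[of UNIV]) (intro continuous_intros, auto)
  from continuous_attains_sup[OF K _ this] coords_mem[OF x0]
  obtain f where f: "f \<in> box \<inter> unit \<inter> perp"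
    and max: "\<And>g. g \<in> box \<inter> unit \<inter> perp \<Longrightarrow>
      vec q g \<bullet> (S *\<^sub>v vec q g) \<le> vec q f \<bullet> (S *\<^sub>v vec q f)"
    by blast
  show thesis
  proof (rule that[of "vec q f"])
    show "y \<bullet> (S *\<^sub>v y) \<le> vec q f \<bullet> (S *\<^sub>v vec q f)"
      if "y \<in> carrier_vec q" "y \<bullet> y = 1" "\<forall>w\<in>W. w \<bullet> y = 0" for y
      using max[OF coords_mem[OF that]] vec_coords[OF that(1)] by simp
  qed (use f in \<open>auto simp: unit_def perp_def\<close>)
qed

text \<open>
  The residual \<open>r = S x - l x\<close>, with \<open>l\<close> the maximal value, satisfies the constraints again because
  \<open>S\<close> is symmetric and maps each \<open>w\<close> to a multiple of itself. Maximality says that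
  \<open>y \<bullet> S y - l (y \<bullet> y)\<close> is nonpositive under the constraints and zero at \<open>x\<close>; moving to \<open>x + t r\<close>
  changes it to first order by \<open>2 t (r \<bullet> r)\<close>, so \<open>r = 0\<close>.
\<close>

lemma constrained_maximizer_is_eigenvector:
  fixes S :: "real mat"
  assumes S: "S \<in> carrier_mat q q" and sym: "transpose_mat S = S"
    and W: "W \<subseteq> carrier_vec q" and inv: "\<And>w. w \<in> W \<Longrightarrow> \<exists>c. S *\<^sub>v w = c \<cdot>\<^sub>v w"
    and x: "x \<in> carrier_vec q" "x \<bullet> x = 1" "\<forall>w\<in>W. w \<bullet> x = 0"
    and max: "\<And>y. \<lbrakk>y \<in> carrier_vec q; y \<bullet> y = 1; \<forall>w\<in>W. w \<bullet> y = 0\<rbrakk>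
      \<Longrightarrow> y \<bullet> (S *\<^sub>v y) \<le> x \<bullet> (S *\<^sub>v x)"
  shows "S *\<^sub>v x = (x \<bullet> (S *\<^sub>v x)) \<cdot>\<^sub>v x"
proof -
  define l where "l = x \<bullet> (S *\<^sub>v x)"
  define r where "r = S *\<^sub>v x - l \<cdot>\<^sub>v x"
  have Sx: "S *\<^sub>v x \<in> carrier_vec q" and r: "r \<in> carrier_vec q"
    using S x by (auto simp: r_def)
  \<comment> \<open>Homogeneity removes the normalization \<open>y \<bullet> y = 1\<close>.\<close>
  have le: "y \<bullet> (S *\<^sub>v y) \<le> l * (y \<bullet> y)" if y: "y \<in> carrier_vec q" "\<forall>w\<in>W. w \<bullet> y = 0" for y
  proof (cases "y = 0\<^sub>v q")
    case True
    then show ?thesis using S by simp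
  next
    case False
    define s where "s = sqrt (y \<bullet> y)"
    have s: "s > 0" "s * s = y \<bullet> y"
      using scalar_prod_self_pos[OF y(1) False] by (auto simp: s_def)
    define z where "z = (1/s) \<cdot>\<^sub>v y"
    have z: "z \<in> carrier_vec q" "y = s \<cdot>\<^sub>v z"
      using y s by (auto simp: z_def smult_smult_assoc)
    have "z \<bullet> z = 1"
      using y s(1) by (simp add: z_def s(2)[symmetric])
    moreover have "\<forall>w\<in>W. w \<bullet> z = 0"
      using y W by (auto simp: z_def)
    ultimately have "z \<bullet> (S *\<^sub>v z) \<le> l"
      unfolding l_def using z by (intro max)
    moreover have "y \<bullet> (S *\<^sub>v y) = (s * s) * (z \<bullet> (S *\<^sub>v z))"
      using z S by (simp add: mult_mat_vec[OF S z(1)])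
    ultimately have "y \<bullet> (S *\<^sub>v y) \<le> (s * s) * l"
      using s(1) by (simp add: mult_left_mono)
    then show ?thesis
      using s(2) by (simp add: mult.commute)
  qed
  have rW: "\<forall>w\<in>W. w \<bullet> r = 0"
  proof
    fix w assume w: "w \<in> W"
    then have wc: "w \<in> carrier_vec q" using W by auto
    obtain c where "S *\<^sub>v w = c \<cdot>\<^sub>v w" using inv[OF w] by auto
    then have "w \<bullet> (S *\<^sub>v x) = 0"
      using symmetric_mat_adjoint[OF S sym wc x(1)] w x wc by simp
    then show "w \<bullet> r = 0"
      using w x wc Sx by (simp add: r_def scalar_prod_minus_distrib[of _ q])
  qed
  define a where "a = r \<bullet> r"
  have rSx: "r \<bullet> (S *\<^sub>v x) = l * (r \<bullet> x) + a"
  proof -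
    have "a = r \<bullet> (S *\<^sub>v x) - l * (r \<bullet> x)"
      unfolding a_def by (subst (2) r_def) (use r x Sx in \<open>simp add: scalar_prod_minus_distrib[of _ q]\<close>)
    then show ?thesis by simp
  qed
  define b where "b = l * a - r \<bullet> (S *\<^sub>v r)"
  \<comment> \<open>The bound \<open>le\<close> at \<open>x + t r\<close>; the terms linear in \<open>r \<bullet> x\<close> cancel.\<close>
  have *: "2 * t * a \<le> t\<^sup>2 * b" for t
  proof -
    define y where "y = x + t \<cdot>\<^sub>v r"
    have y: "y \<in> carrier_vec q" "\<forall>w\<in>W. w \<bullet> y = 0"
      using x r rW W by (auto simp: y_def scalar_prod_add_distrib[of _ q])
    have Sr: "S *\<^sub>v r \<in> carrier_vec q" using S r by auto
    have "y \<bullet> y = 1 + 2 * t * (r \<bullet> x) + t\<^sup>2 * a"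
      using x r by (simp add: y_def a_def scalar_prod_add_distrib[of _ q] add_scalar_prod_distrib[of _ q]
        comm_scalar_prod[of x q r] algebra_simps power2_eq_square)
    moreover have "x \<bullet> (S *\<^sub>v r) = r \<bullet> (S *\<^sub>v x)"
      using symmetric_mat_adjoint[OF S sym x(1) r] comm_scalar_prod[OF Sx r] by simp
    then have "y \<bullet> (S *\<^sub>v y) = l + 2 * t * (r \<bullet> (S *\<^sub>v x)) + t\<^sup>2 * (r \<bullet> (S *\<^sub>v r))"
      using x r S Sx Sr
      by (simp add: y_def l_def mult_add_distrib_mat_vec[OF S] mult_mat_vec[OF S]
        scalar_prod_add_distrib[of _ q] add_scalar_prod_distrib[of _ q]
        algebra_simps power2_eq_square)
    ultimately show ?thesis
      using le[OF y] unfolding rSx b_def by (simp add: algebra_simps)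
  qed
  have "a = 0"
  proof (rule ccontr)
    assume "a \<noteq> 0"
    then have a: "a > 0" using scalar_prod_self_nonneg[of r] by (simp add: a_def)
    with *[of 1] have "b > 0" by simp
    \<comment> \<open>At \<open>t = a / b\<close> the linear term \<open>2 a\<^sup>2 / b\<close> exceeds the quadratic term \<open>a\<^sup>2 / b\<close>.\<close>
    with *[of "a / b"] a show False
      by (simp add: power2_eq_square field_simps)
  qed
  then have "r = 0\<^sub>v q"
    using scalar_prod_self_pos[OF r] by (auto simp: a_def)
  then have "(S *\<^sub>v x - l \<cdot>\<^sub>v x) $ i = 0" if "i < q" for i
    using that by (simp add: r_def)
  then show ?thesis
    using S Sx x by (intro eq_vecI) (auto simp: l_def)
qed

section \<open>The spectral theorem for real symmetric matrices\<close>

text \<open>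
  Fewer than \<open>q\<close> vectors, completed by zero rows to a square matrix, give a singular matrix; any
  nonzero vector of its kernel can be normalized.
\<close>

lemma unit_vector_orthogonal_to_fewer:
  fixes u :: "nat \<Rightarrow> real vec"
  assumes k: "k < q" and u: "\<And>i. i < k \<Longrightarrow> u i \<in> carrier_vec q"
  obtains x where "x \<in> carrier_vec q" "x \<bullet> x = 1" "\<And>i. i < k \<Longrightarrow> u i \<bullet> x = 0"
proof -
  define c where "c i = (if i < k then u i else 0\<^sub>v q)" for i
  define M where "M = mat\<^sub>r q q (\<lambda>i. if i = k then 0\<^sub>v q else c i)"
  have c: "c i \<in> carrier_vec q" for i using u by (simp add: c_def)
  have M: "M \<in> carrier_mat q q" by (simp add: M_def)
  have "det M = 0" unfolding M_def using k c by (intro det_row_0) auto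
  then obtain y where y: "y \<in> carrier_vec q" "y \<noteq> 0\<^sub>v q" "M *\<^sub>v y = 0\<^sub>v q"
    using det_0_iff_vec_prod_zero[OF M] by blast
  have orth: "u i \<bullet> y = 0" if "i < k" for i
  proof -
    have "(M *\<^sub>v y) $ i = row M i \<bullet> y" using that k M by simp
    moreover have "row M i = u i" using that k u[OF that] by (auto simp: M_def c_def)
    ultimately show ?thesis using y(3) that k by simp
  qed
  have pos: "0 < y \<bullet> y" by (rule scalar_prod_self_pos[OF y(1,2)])
  show thesis
  proof (rule that[of "(1 / sqrt (y \<bullet> y)) \<cdot>\<^sub>v y"])
    show "u i \<bullet> ((1 / sqrt (y \<bullet> y)) \<cdot>\<^sub>v y) = 0" if "i < k" for i
      using orth[OF that] u[OF that] y(1) by simp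
  qed (use y(1) pos in auto)
qed

text \<open>
  Induction on the number of vectors: the constraint set of the next maximization is nonempty as
  long as \<open>k < q\<close>, and a maximizer on the complement of the previous eigenvectors is the next one.
\<close>

lemma orthonormal_eigenvectors:
  fixes S :: "real mat"
  assumes S: "S \<in> carrier_mat q q" and sym: "transpose_mat S = S" and "k \<le> q"
  shows "\<exists>u l. \<forall>i<k. u i \<in> carrier_vec q \<and> S *\<^sub>v u i = l i \<cdot>\<^sub>v u i \<and>
    (\<forall>j<k. u i \<bullet> u j = (if i = j then 1 else 0))"
  using assms(3)
proof (induction k)
  case 0
  then show ?case by simp
next
  case (Suc k)
  then obtain u l where u: "\<And>i. i < k \<Longrightarrow> u i \<in> carrier_vec q"
    and eig: "\<And>i. i < k \<Longrightarrow> S *\<^sub>v u i = l i \<cdot>\<^sub>v u i"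
    and on: "\<And>i j. i < k \<Longrightarrow> j < k \<Longrightarrow> u i \<bullet> u j = (if i = j then 1 else 0)"
    by fastforce
  obtain x0 where x0: "x0 \<in> carrier_vec q" "x0 \<bullet> x0 = 1" "\<And>i. i < k \<Longrightarrow> u i \<bullet> x0 = 0"
    using unit_vector_orthogonal_to_fewer[of k q u] u Suc.prems by auto
  define W where "W = u ` {..<k}"
  have W: "W \<subseteq> carrier_vec q" using u by (auto simp: W_def)
  have "\<forall>w\<in>W. w \<bullet> x0 = 0" using x0 by (auto simp: W_def)
  then obtain x where x: "x \<in> carrier_vec q" "x \<bullet> x = 1" "\<forall>w\<in>W. w \<bullet> x = 0"
    and max: "\<And>y. \<lbrakk>y \<in> carrier_vec q; y \<bullet> y = 1; \<forall>w\<in>W. w \<bullet> y = 0\<rbrakk>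
      \<Longrightarrow> y \<bullet> (S *\<^sub>v y) \<le> x \<bullet> (S *\<^sub>v x)"
    using quadratic_form_attains_max[OF S W x0(1,2)] by metis
  have "\<exists>c. S *\<^sub>v w = c \<cdot>\<^sub>v w" if "w \<in> W" for w
    using that eig by (auto simp: W_def)
  then have Sx: "S *\<^sub>v x = (x \<bullet> (S *\<^sub>v x)) \<cdot>\<^sub>v x"
    by (intro constrained_maximizer_is_eigenvector[OF S sym W _ x max])
  have ux: "u i \<bullet> x = 0" "x \<bullet> u i = 0" if "i < k" for i
    using that x u comm_scalar_prod[OF x(1) u[OF that]] by (auto simp: W_def)
  show ?case
    by (rule exI[of _ "u(k := x)"], rule exI[of _ "l(k := x \<bullet> (S *\<^sub>v x))"])
      (use u eig on x Sx ux in \<open>auto simp: less_Suc_eq\<close>)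
qed

theorem real_spectral_theorem:
  fixes S :: "real mat"
  assumes S: "S \<in> carrier_mat q q" and sym: "transpose_mat S = S"
  obtains U l where "U \<in> carrier_mat q q" "transpose_mat U * U = 1\<^sub>m q" "U * transpose_mat U = 1\<^sub>m q"
    "S = U * mat_diag q l * transpose_mat U"
    "\<And>i. i < q \<Longrightarrow> eigenvalue S (l i)"
proof -
  obtain u l where u: "\<And>i. i < q \<Longrightarrow> u i \<in> carrier_vec q"
    and eig: "\<And>i. i < q \<Longrightarrow> S *\<^sub>v u i = l i \<cdot>\<^sub>v u i"
    and on: "\<And>i j. i < q \<Longrightarrow> j < q \<Longrightarrow> u i \<bullet> u j = (if i = j then 1 else 0)"
    using orthonormal_eigenvectors[OF S sym le_refl] by blast
  define U where "U = mat q q (\<lambda>(i, j). u j $ i)"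
  have U: "U \<in> carrier_mat q q" by (simp add: U_def)
  have col: "col U j = u j" if "j < q" for j
    using that u[OF that] by (auto simp: U_def)
  have UtU: "transpose_mat U * U = 1\<^sub>m q"
    using U by (intro eq_matI) (auto simp: col on)
  then have UUt: "U * transpose_mat U = 1\<^sub>m q"
    using U by (intro mat_mult_left_right_inverse[of "transpose_mat U"]) auto
  have SU: "S * U = U * mat_diag q l"
  proof (rule mat_col_eqI)
    fix j assume "j < dim_col (U * mat_diag q l)"
    then have j: "j < q" by (simp add: mat_diag_def)
    have "col (S * U) j = S *\<^sub>v col U j"
      using S U j by (intro col_mult2)
    also have "\<dots> = l j \<cdot>\<^sub>v col U j" using eig j col by simp
    also have "\<dots> = col (U * mat_diag q l) j"
      using U j by (auto simp: mat_diag_mult_right[OF U])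
    finally show "col (S * U) j = col (U * mat_diag q l) j" .
  qed (use S U in \<open>auto simp: mat_diag_def\<close>)
  have "S = S * (U * transpose_mat U)" using UUt S by simp
  also have "\<dots> = S * U * transpose_mat U" using S U by simp
  finally have decomp: "S = U * mat_diag q l * transpose_mat U" by (simp add: SU)
  have "eigenvalue S (l i)" if i: "i < q" for i
  proof -
    have "u i \<noteq> 0\<^sub>v q" using on[OF i i] u[OF i] by auto
    then show ?thesis
      unfolding eigenvalue_def eigenvector_def using S u[OF i] eig[OF i] by auto
  qed
  with U UtU UUt decomp that show thesis by blast
qed

lemma quadratic_form_mat_diag:
  fixes f :: "nat \<Rightarrow> real"
  assumes "y \<in> carrier_vec q"
  shows "y \<bullet> (mat_diag q f *\<^sub>v y) = (\<Sum>i<q. f i * (y $ i)\<^sup>2)"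
proof -
  have "mat_diag q f *\<^sub>v y = vec q (\<lambda>i. f i * y $ i)"
  proof (rule eq_vecI)
    fix i assume "i < dim_vec (vec q (\<lambda>i. f i * y $ i))"
    then have i: "i < q" by simp
    have "(mat_diag q f *\<^sub>v y) $ i = (\<Sum>j = 0..<q. (if i = j then f j else 0) * y $ j)"
      using i assms by (simp add: mat_diag_def scalar_prod_def)
    also have "\<dots> = (\<Sum>j = 0..<q. if i = j then f j * y $ j else 0)"
      by (intro sum.cong) auto
    also have "\<dots> = f i * y $ i" using i by simp
    finally show "(mat_diag q f *\<^sub>v y) $ i = vec q (\<lambda>i. f i * y $ i) $ i" using i by simp
  qed (simp add: mat_diag_def)
  then show ?thesis
    by (simp add: scalar_prod_def atLeast0LessThan power2_eq_square ac_simps)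
qed

lemma quadratic_form_diag_congruence:
  fixes U :: "real mat"
  assumes U: "U \<in> carrier_mat q q" and x: "x \<in> carrier_vec q"
  shows "x \<bullet> ((U * mat_diag q f * transpose_mat U) *\<^sub>v x)
    = (\<Sum>i<q. f i * ((transpose_mat U *\<^sub>v x) $ i)\<^sup>2)"
proof -
  have y: "transpose_mat U *\<^sub>v x \<in> carrier_vec q" using U x by simp
  have "x \<bullet> ((U * mat_diag q f * transpose_mat U) *\<^sub>v x)
    = x \<bullet> (U *\<^sub>v (mat_diag q f *\<^sub>v (transpose_mat U *\<^sub>v x)))"
    using U x y by (simp add: assoc_mult_mat_vec[of _ q q _ q] mult_carrier_mat[of _ q q])
  also have "\<dots> = (transpose_mat U *\<^sub>v x) \<bullet> (mat_diag q f *\<^sub>v (transpose_mat U *\<^sub>v x))"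
    using U x y by (intro transpose_vec_mult_scalar[symmetric, of _ q q]) (auto intro: mult_mat_vec_carrier[of _ q q])
  finally show ?thesis by (simp add: quadratic_form_mat_diag[OF y])
qed

text \<open>
  In the coordinates \<open>y = U\<^sup>T x\<close> of an orthonormal eigenbasis the form is a sum of squares weighted
  by the eigenvalues, while the norm is preserved.
\<close>

lemma rayleigh_le_max_eigenvalue:
  fixes S :: "real mat"
  assumes S: "S \<in> carrier_mat q q" and sym: "transpose_mat S = S"
    and le: "\<And>l. eigenvalue S l \<Longrightarrow> l \<le> c" and x: "x \<in> carrier_vec q"
  shows "x \<bullet> (S *\<^sub>v x) \<le> c * (x \<bullet> x)"
proof -
  obtain U l where U: "U \<in> carrier_mat q q" "U * transpose_mat U = 1\<^sub>m q"
    and S_eq: "S = U * mat_diag q l * transpose_mat U"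
    and eig: "\<And>i. i < q \<Longrightarrow> eigenvalue S (l i)"
    using real_spectral_theorem[OF S sym] by metis
  define y where "y = transpose_mat U *\<^sub>v x"
  have y: "y \<in> carrier_vec q" using U x by (simp add: y_def)
  have "U *\<^sub>v y = x"
    unfolding y_def using U x by (simp flip: assoc_mult_mat_vec[of _ q q _ q])
  then have "y \<bullet> y = x \<bullet> x"
    unfolding y_def by (subst transpose_vec_mult_scalar[of _ q q]) (use U x y y_def in auto)
  then have norm: "(\<Sum>i<q. (y $ i)\<^sup>2) = x \<bullet> x"
    using y by (simp add: scalar_prod_def atLeast0LessThan power2_eq_square)
  have "x \<bullet> (S *\<^sub>v x) = (\<Sum>i<q. l i * (y $ i)\<^sup>2)"
    by (simp add: S_eq quadratic_form_diag_congruence[OF U(1) x] y_def)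
  also have "\<dots> \<le> (\<Sum>i<q. c * (y $ i)\<^sup>2)"
    using eig by (intro sum_mono mult_right_mono le) auto
  also have "\<dots> = c * (x \<bullet> x)" by (simp add: norm flip: sum_distrib_left)
  finally show ?thesis .
qed

section \<open>The principal square root\<close>

lemma pos_semidefD:
  assumes "pos_semidef M" "M \<in> carrier_mat q q'"
  shows "transpose_mat M = M" "x \<in> carrier_vec q \<Longrightarrow> 0 \<le> x \<bullet> (M *\<^sub>v x)"
  using assms by (auto simp: pos_semidef_def)

lemma pos_semidef_carrier:
  "pos_semidef M \<Longrightarrow> M \<in> carrier_mat (dim_row M) (dim_row M)"
  unfolding pos_semidef_def by (metis carrier_matI index_transpose_mat(2))

lemma pos_def_imp_pos_semidef:
  assumes M: "pos_def M"
  shows "pos_semidef M"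
  unfolding pos_semidef_def
proof (intro conjI ballI)
  show sym: "transpose_mat M = M" using M by (simp only: pos_def_def)
  fix x :: "real vec" assume x: "x \<in> carrier_vec (dim_row M)"
  have "M *\<^sub>v x \<in> carrier_vec (dim_row M)" by (rule carrier_vecI) simp
  then have "x = 0\<^sub>v (dim_row M) \<Longrightarrow> x \<bullet> (M *\<^sub>v x) = 0"
    using scalar_prod_left_zero by metis
  moreover have "x \<noteq> 0\<^sub>v (dim_row M) \<Longrightarrow> 0 < x \<bullet> (M *\<^sub>v x)"
    using M x unfolding pos_def_def by blast
  ultimately show "0 \<le> x \<bullet> (M *\<^sub>v x)" by linarith
qed

lemma pos_semidef_eigenvalue_nonneg:
  assumes M: "pos_semidef M" and "eigenvalue M l"
  shows "0 \<le> l"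
proof -
  have c: "M \<in> carrier_mat (dim_row M) (dim_row M)" by (rule pos_semidef_carrier[OF M])
  obtain x where x: "x \<in> carrier_vec (dim_row M)" "x \<noteq> 0\<^sub>v (dim_row M)" "M *\<^sub>v x = l \<cdot>\<^sub>v x"
    using assms(2) unfolding eigenvalue_def eigenvector_def by blast
  have "0 \<le> l * (x \<bullet> x)"
    using pos_semidefD(2)[OF M c x(1)] x by simp
  with scalar_prod_self_pos[OF x(1,2)] show ?thesis
    by (simp add: zero_le_mult_iff)
qed

text \<open>
  Take square roots of the eigenvalues in a spectral decomposition.
\<close>

lemma pos_semidef_sqrt_exists:
  assumes M: "pos_semidef M"
  shows "\<exists>R. pos_semidef R \<and> R * R = M"
proof -
  define q where "q = dim_row M"
  have c: "M \<in> carrier_mat q q" unfolding q_def by (rule pos_semidef_carrier[OF M])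
  obtain U l where U: "U \<in> carrier_mat q q" "transpose_mat U * U = 1\<^sub>m q"
    and M_eq: "M = U * mat_diag q l * transpose_mat U"
    and eig: "\<And>i. i < q \<Longrightarrow> eigenvalue M (l i)"
    using real_spectral_theorem[OF c pos_semidefD(1)[OF M c]] by metis
  have l: "0 \<le> l i" if "i < q" for i
    using pos_semidef_eigenvalue_nonneg[OF M eig[OF that]] .
  let ?D = "mat_diag q (\<lambda>i. sqrt (l i))"
  define R where "R = U * ?D * transpose_mat U"
  have D: "?D \<in> carrier_mat q q" "transpose_mat ?D = ?D"
    by (auto simp: mat_diag_def intro!: eq_matI)
  have R: "R \<in> carrier_mat q q" using U D by (simp add: R_def mult_carrier_mat[of _ q q])
  have "transpose_mat R = R"
    unfolding R_def using U D
    by (simp add: transpose_mult[of _ q q _ q] mult_carrier_mat[of _ q q] assoc_mult_mat[of _ q q _ q _ q])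
  moreover have "0 \<le> x \<bullet> (R *\<^sub>v x)" if "x \<in> carrier_vec q" for x
    unfolding R_def quadratic_form_diag_congruence[OF U(1) that] using l
    by (intro sum_nonneg) auto
  moreover have "R * R = M"
  proof -
    have "R * R = U * ?D * (transpose_mat U * U) * ?D * transpose_mat U"
      unfolding R_def using U(1) D
      by (simp add: mult_carrier_mat[of _ q q] assoc_mult_mat[of _ q q _ q _ q])
    also have "\<dots> = U * (?D * ?D) * transpose_mat U"
      unfolding U(2) using U(1) D
      by (simp add: left_mult_one_mat[of _ q q] mult_carrier_mat[of _ q q] assoc_mult_mat[of _ q q _ q _ q] del: mat_diag_diag)
    also have "?D * ?D = mat_diag q l"
      unfolding mat_diag_diag using l by (auto simp: mat_diag_def intro!: eq_matI)
    finally show ?thesis by (simp add: M_eq)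
  qed
  ultimately show ?thesis using R by (auto simp: pos_semidef_def)
qed

text \<open>
  It suffices that the symmetric matrix \<open>R - T\<close> has no nonzero eigenvalue. If \<open>(R - T) x = l x\<close>,
  then \<open>\<parallel>R x\<parallel> = \<parallel>T x\<parallel>\<close> because the squares agree, so
  \<open>0 = (R x - T x) \<bullet> (R x + T x) = l (x \<bullet> R x + x \<bullet> T x)\<close>. For \<open>l \<noteq> 0\<close> both nonnegative summands
  vanish, and then so does their difference \<open>l (x \<bullet> x)\<close>.
\<close>

lemma pos_semidef_sqrt_unique:
  assumes R: "pos_semidef R" "R \<in> carrier_mat q q" and T: "pos_semidef T" "T \<in> carrier_mat q q"
    and eq: "R * R = T * T"
  shows "R = T"
proof -
  note symR = pos_semidefD(1)[OF R] and symT = pos_semidefD(1)[OF T]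
  define X where "X = R - T"
  have X: "X \<in> carrier_mat q q" using R T by (simp add: X_def minus_carrier_mat)
  have symX: "transpose_mat X = X"
    using R(2) T(2) symR symT by (simp add: X_def transpose_minus)
  have zero: "l = 0" if eig: "eigenvalue X l" for l
  proof (rule ccontr)
    assume "l \<noteq> 0"
    obtain x where x: "x \<in> carrier_vec q" "x \<noteq> 0\<^sub>v q" "X *\<^sub>v x = l \<cdot>\<^sub>v x"
      using eig X unfolding eigenvalue_def eigenvector_def by auto
    define r t where "r = R *\<^sub>v x" and "t = T *\<^sub>v x"
    have rt: "r \<in> carrier_vec q" "t \<in> carrier_vec q" using R T x by (auto simp: r_def t_def)
    have diff: "r - t = l \<cdot>\<^sub>v x"
      using x R T by (simp add: r_def t_def X_def minus_mult_distrib_mat_vec[of _ q q])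
    have "r \<bullet> r = x \<bullet> ((R * R) *\<^sub>v x)"
      using symmetric_mat_adjoint[OF R(2) symR x(1) rt(1)] R x rt by (simp add: r_def)
    moreover have "t \<bullet> t = x \<bullet> ((T * T) *\<^sub>v x)"
      using symmetric_mat_adjoint[OF T(2) symT x(1) rt(2)] T x rt by (simp add: t_def)
    ultimately have "r \<bullet> r = t \<bullet> t" by (simp add: eq)
    then have "(r - t) \<bullet> (r + t) = 0"
      using rt by (simp add: minus_scalar_prod_distrib[of _ q] scalar_prod_add_distrib[of _ q]
          comm_scalar_prod[of r q t])
    then have "x \<bullet> r + x \<bullet> t = 0"
      using \<open>l \<noteq> 0\<close> x rt by (simp add: diff scalar_prod_add_distrib[of _ q] flip: distrib_left)
    moreover have "0 \<le> x \<bullet> r" "0 \<le> x \<bullet> t"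
      using pos_semidefD(2)[OF R x(1)] pos_semidefD(2)[OF T x(1)] by (auto simp: r_def t_def)
    ultimately have "x \<bullet> (r - t) = 0"
      using x rt by (simp add: scalar_prod_minus_distrib[of _ q])
    then show False
      using scalar_prod_self_pos[OF x(1,2)] \<open>l \<noteq> 0\<close> x by (simp add: diff)
  qed
  obtain U l where U: "U \<in> carrier_mat q q"
    and X_eq: "X = U * mat_diag q l * transpose_mat U"
    and eig: "\<And>i. i < q \<Longrightarrow> eigenvalue X (l i)"
    using real_spectral_theorem[OF X symX] by metis
  have "mat_diag q l = 0\<^sub>m q q"
    using zero[OF eig] by (auto simp: mat_diag_def intro!: eq_matI)
  then have "X = 0\<^sub>m q q" using U by (simp add: X_eq)
  then have "(R - T) $$ (i, j) = 0" if "i < q" "j < q" for i j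
    using that by (simp add: X_def)
  then show ?thesis
    using R(2) T(2) by (intro eq_matI) auto
qed

text \<open>
  The description defining \<open>mat_sqrt\<close> ranges over matrices of every size; the product \<open>R * R = M\<close>
  fixes the size of \<open>R\<close>, so uniqueness among matrices of one size is enough.
\<close>

lemma mat_sqrt:
  assumes M: "pos_semidef M"
  shows "pos_semidef (mat_sqrt M)" "mat_sqrt M * mat_sqrt M = M"
proof -
  have "\<exists>!R. pos_semidef R \<and> R * R = M"
  proof (rule ex_ex1I[OF pos_semidef_sqrt_exists[OF M]])
    fix R T assume RT: "pos_semidef R \<and> R * R = M" "pos_semidef T \<and> T * T = M"
    then have "dim_row R = dim_row M" "dim_row T = dim_row M" by (metis index_mult_mat(2))+
    then have "R \<in> carrier_mat (dim_row M) (dim_row M)" "T \<in> carrier_mat (dim_row M) (dim_row M)"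
      using RT pos_semidef_carrier by metis+
    then show "R = T" using RT pos_semidef_sqrt_unique by blast
  qed
  from theI'[OF this] show "pos_semidef (mat_sqrt M)" "mat_sqrt M * mat_sqrt M = M"
    by (auto simp: mat_sqrt_def)
qed

lemma mat_sqrt_carrier:
  assumes M: "pos_semidef M" "M \<in> carrier_mat q q"
  shows "mat_sqrt M \<in> carrier_mat q q"
  using pos_semidef_carrier[OF mat_sqrt(1)[OF M(1)]] mat_sqrt(2)[OF M(1)] M(2)
  by (metis carrier_matD(1) index_mult_mat(2))

lemma norm_mat_sqrt_mult:
  assumes M: "pos_semidef M" "M \<in> carrier_mat q q" and x: "x \<in> carrier_vec q"
  shows "vec_norm2 (mat_sqrt M *\<^sub>v x) = sqrt (x \<bullet> (M *\<^sub>v x))"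
proof -
  let ?R = "mat_sqrt M"
  have R: "?R \<in> carrier_mat q q" by (rule mat_sqrt_carrier[OF M])
  have Rx: "?R *\<^sub>v x \<in> carrier_vec q" using R x by simp
  have "(?R *\<^sub>v x) \<bullet> (?R *\<^sub>v x) = x \<bullet> ((?R * ?R) *\<^sub>v x)"
    using symmetric_mat_adjoint[OF R pos_semidefD(1)[OF mat_sqrt(1)[OF M(1)] R] x Rx] R x by simp
  then show ?thesis by (simp add: vec_norm2_def mat_sqrt(2)[OF M(1)])
qed

section \<open>The largest singular value\<close>

lemma scalar_prod_gram:
  fixes M :: "real mat"
  assumes "M \<in> carrier_mat n q" "x \<in> carrier_vec q" "y \<in> carrier_vec q"
  shows "x \<bullet> ((transpose_mat M * M) *\<^sub>v y) = (M *\<^sub>v x) \<bullet> (M *\<^sub>v y)"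
  using assms transpose_vec_mult_scalar[of "transpose_mat M" q n "M *\<^sub>v y" x]
  by simp

lemma pos_semidef_gram:
  fixes M :: "real mat"
  assumes "M \<in> carrier_mat n q"
  shows "pos_semidef (transpose_mat M * M)"
  using assms unfolding pos_semidef_def
  by (auto simp: transpose_mult[of _ q n] scalar_prod_gram scalar_prod_self_nonneg simp del: assoc_mult_mat_vec)

lemma finite_eigenvalues:
  fixes M :: "real mat"
  assumes M: "M \<in> carrier_mat q q"
  shows "finite {l. eigenvalue M l}"
proof -
  have "char_poly M \<noteq> 0" using degree_monic_char_poly[OF M] by auto
  then show ?thesis
    using poly_roots_finite by (simp add: eigenvalue_root_char_poly[OF M])
qed

text \<open>
  The square of the largest singular value is an eigenvalue \<open>s\<close> of the Gram matrix \<open>M\<^sup>T M\<close>, whose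
  quadratic form is \<open>\<parallel>M x\<parallel>\<^sup>2\<close>. An upper bound of \<open>s\<close> bounds the form by the spectral theorem, and
  a bound on the form is tested at an eigenvector for \<open>s\<close>. For \<open>q = 0\<close> there are no eigenvalues and
  the maximum would be undefined.
\<close>

lemma sigma_max_square_le_iff:
  fixes M :: "real mat"
  assumes M: "M \<in> carrier_mat n q" and q: "0 < q"
  shows "(sigma_max M)\<^sup>2 \<le> r \<longleftrightarrow> (\<forall>x\<in>carrier_vec q. (M *\<^sub>v x) \<bullet> (M *\<^sub>v x) \<le> r * (x \<bullet> x))"
proof -
  define G where "G = transpose_mat M * M"
  have G: "G \<in> carrier_mat q q" using M by (simp add: G_def)
  have psd: "pos_semidef G" unfolding G_def by (rule pos_semidef_gram[OF M])
  note sym = pos_semidefD(1)[OF psd G]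
  define E where "E = {sqrt l | l. eigenvalue G l}"
  have "E = sqrt ` {l. eigenvalue G l}" by (auto simp: E_def)
  then have fin: "finite E" using finite_eigenvalues[OF G] by simp
  have "E \<noteq> {}"
  proof -
    obtain U l where "\<And>i. i < q \<Longrightarrow> eigenvalue G (l i)"
      using real_spectral_theorem[OF G sym] by metis
    then show ?thesis using q by (auto simp: E_def)
  qed
  with fin have "Max E \<in> E" by simp
  moreover have sigma: "sigma_max M = Max E" by (simp add: sigma_max_def E_def G_def)
  ultimately obtain s where s: "eigenvalue G s" "sigma_max M = sqrt s" by (auto simp: E_def)
  have sq: "(sigma_max M)\<^sup>2 = s"
    using pos_semidef_eigenvalue_nonneg[OF psd s(1)] s(2) by simp
  have top: "l \<le> s" if "eigenvalue G l" for l
  proof -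
    have "sqrt l \<le> sqrt s"
      using that fin unfolding s(2)[symmetric] sigma by (intro Max_ge) (auto simp: E_def)
    then show ?thesis by simp
  qed
  have gram: "x \<bullet> (G *\<^sub>v x) = (M *\<^sub>v x) \<bullet> (M *\<^sub>v x)" if "x \<in> carrier_vec q" for x
    unfolding G_def by (rule scalar_prod_gram[OF M that that])
  show ?thesis
  proof
    assume "(sigma_max M)\<^sup>2 \<le> r"
    then show "\<forall>x\<in>carrier_vec q. (M *\<^sub>v x) \<bullet> (M *\<^sub>v x) \<le> r * (x \<bullet> x)"
      using rayleigh_le_max_eigenvalue[OF G sym, of r] top by (fastforce simp: sq gram)
  next
    assume le: "\<forall>x\<in>carrier_vec q. (M *\<^sub>v x) \<bullet> (M *\<^sub>v x) \<le> r * (x \<bullet> x)"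
    obtain x where x: "x \<in> carrier_vec q" "x \<noteq> 0\<^sub>v q" "G *\<^sub>v x = s \<cdot>\<^sub>v x"
      using s(1) G unfolding eigenvalue_def eigenvector_def by auto
    have "s * (x \<bullet> x) \<le> r * (x \<bullet> x)"
      using le x gram[OF x(1)] by simp
    with scalar_prod_self_pos[OF x(1,2)] show "(sigma_max M)\<^sup>2 \<le> r"
      by (simp add: sq)
  qed
qed

section \<open>A Schur complement\<close>

text \<open>
  Completing the square, the form at \<open>(x, y)\<close> equals \<open>\<parallel>x + M y\<parallel>\<^sup>2 + r \<parallel>y\<parallel>\<^sup>2 - \<parallel>M y\<parallel>\<^sup>2\<close>, whose
  minimum over \<open>x\<close> is attained at \<open>x = - M y\<close>.
\<close>

lemma schur_complement_identity_block:
  fixes M :: "real mat"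
  assumes M: "M \<in> carrier_mat n q"
  shows "pos_semidef (four_block_mat (1\<^sub>m n) M (transpose_mat M) (r \<cdot>\<^sub>m 1\<^sub>m q))
    \<longleftrightarrow> (\<forall>y\<in>carrier_vec q. (M *\<^sub>v y) \<bullet> (M *\<^sub>v y) \<le> r * (y \<bullet> y))"
proof -
  let ?F = "four_block_mat (1\<^sub>m n) M (transpose_mat M) (r \<cdot>\<^sub>m 1\<^sub>m q)"
  have F: "?F \<in> carrier_mat (n + q) (n + q)" using M by auto
  have sym: "transpose_mat ?F = ?F"
    using M by (subst transpose_four_block_mat[of _ n n _ q _ q]) (auto intro!: eq_matI)
  have form: "(x @\<^sub>v y) \<bullet> (?F *\<^sub>v (x @\<^sub>v y))
      = (x + M *\<^sub>v y) \<bullet> (x + M *\<^sub>v y) + r * (y \<bullet> y) - (M *\<^sub>v y) \<bullet> (M *\<^sub>v y)"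
    if x: "x \<in> carrier_vec n" and y: "y \<in> carrier_vec q" for x y
  proof -
    have My: "M *\<^sub>v y \<in> carrier_vec n" and Mtx: "transpose_mat M *\<^sub>v x \<in> carrier_vec q"
      using M x y by auto
    have "?F *\<^sub>v (x @\<^sub>v y) = (x + M *\<^sub>v y) @\<^sub>v (transpose_mat M *\<^sub>v x + r \<cdot>\<^sub>v y)"
      using M x y by (subst four_block_mat_mult_vec[of _ n n _ q _ q])
        (auto intro!: eq_vecI)
    moreover have "y \<bullet> (transpose_mat M *\<^sub>v x) = x \<bullet> (M *\<^sub>v y)"
      using transpose_vec_mult_scalar[OF M y x] comm_scalar_prod[OF Mtx y] by simp
    ultimately show ?thesis
      using x y My Mtx
      by (simp add: scalar_prod_append[of _ n _ q] scalar_prod_add_distrib[of _ n]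
          scalar_prod_add_distrib[of _ q] add_scalar_prod_distrib[of _ n]
          comm_scalar_prod[of "M *\<^sub>v y" n x])
  qed
  show ?thesis
  proof
    assume psd: "pos_semidef ?F"
    show "\<forall>y\<in>carrier_vec q. (M *\<^sub>v y) \<bullet> (M *\<^sub>v y) \<le> r * (y \<bullet> y)"
    proof
      fix y :: "real vec" assume y: "y \<in> carrier_vec q"
      define x where "x = - (M *\<^sub>v y)"
      have My: "M *\<^sub>v y \<in> carrier_vec n" using M y by simp
      then have x: "x \<in> carrier_vec n" "x + M *\<^sub>v y = 0\<^sub>v n" by (auto simp: x_def)
      have "0 \<le> (x @\<^sub>v y) \<bullet> (?F *\<^sub>v (x @\<^sub>v y))"
        using x y by (intro pos_semidefD(2)[OF psd F]) auto
      then show "(M *\<^sub>v y) \<bullet> (M *\<^sub>v y) \<le> r * (y \<bullet> y)"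
        by (simp add: form[OF x(1) y] x(2))
    qed
  next
    assume le: "\<forall>y\<in>carrier_vec q. (M *\<^sub>v y) \<bullet> (M *\<^sub>v y) \<le> r * (y \<bullet> y)"
    have "0 \<le> z \<bullet> (?F *\<^sub>v z)" if "z \<in> carrier_vec (n + q)" for z
    proof -
      define x y where "x = vec_first z n" and "y = vec_last z q"
      have z: "z = x @\<^sub>v y" using that by (simp add: x_def y_def)
      have xy: "x \<in> carrier_vec n" "y \<in> carrier_vec q" by (auto simp: x_def y_def)
      show ?thesis
        using le xy(2) scalar_prod_self_nonneg[of "x + M *\<^sub>v y"] unfolding z form[OF xy]
        by (smt (verit))
    qed
    then show "pos_semidef ?F" using F sym by (simp add: pos_semidef_def)
  qed
qed

section \<open>The chance constraints as a linear matrix inequality\<close>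

lemma stacked_input_carrier [simp]: "stacked_input N n p A G \<in> carrier_mat ((N + 1) * n) (N * p)"
  by (simp add: stacked_input_def)

lemma block_extract_carrier [simp]: "block_extract N n k \<in> carrier_mat n ((N + 1) * n)"
  by (simp add: block_extract_def)

lemma admissible_L_carrier:
  assumes "L \<in> admissible_L N n m A B"
  shows "L \<in> carrier_mat (N * m) ((N + 1) * n)"
proof -
  let ?q = "(N + 1) * n"
  obtain K M where L: "L = K * M" and K: "K \<in> carrier_mat (N * m) ?q"
    and inv: "mat_inverse (1\<^sub>m ?q - stacked_input N n m A B * K) = Some M"
    using assms unfolding admissible_L_def feedback_gains_def by blast
  have "1\<^sub>m ?q - stacked_input N n m A B * K \<in> carrier_mat ?q ?q"
    by (rule minus_carrier_mat, rule mult_carrier_mat[OF stacked_input_carrier K])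
  from mat_inverse(2)[OF this inv] have "M \<in> carrier_mat ?q ?q" by blast
  with K show ?thesis unfolding L by (rule mult_carrier_mat)
qed

theorem corollary1:
  fixes N n m d J :: nat
    and A B D \<Sigma>w L :: "real mat"
    and x0 v :: "real vec"
    and \<epsilon> :: real
    and \<alpha> :: "nat \<Rightarrow> real vec"
    and \<beta> :: "nat \<Rightarrow> real"
    and \<gamma> :: "nat \<Rightarrow> nat \<Rightarrow> real"
  assumes "0 < N" and "0 < n" and "0 < m" and "0 < d"
    and "A \<in> carrier_mat n n" and "B \<in> carrier_mat n m" and "D \<in> carrier_mat n d"
    and "x0 \<in> carrier_vec n"
    and "\<Sigma>w \<in> carrier_mat (N * d) (N * d)" and "pos_def \<Sigma>w"
    and "0 < \<epsilon>"
    and "\<And>j. j \<le> J \<Longrightarrow> \<alpha> j \<in> carrier_vec n"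
    and "\<And>j k. j \<le> J \<Longrightarrow> k \<le> N \<Longrightarrow> 0 < \<gamma> j k \<and> \<gamma> j k < 1"
    and "v \<in> carrier_vec (N * m)"
    and "L \<in> admissible_L N n m A B"
  shows
    "(\<forall>j \<le> J. \<forall>k \<le> N.
        \<beta> j + \<alpha> j \<bullet> mu_hat N n m A B x0 v k
          + tau (\<gamma> j k) * sqrt (\<alpha> j \<bullet> (Sigma_hat N n m d A B D \<Sigma>w L k *\<^sub>v \<alpha> j))
          + \<epsilon> * sqrt (1 + (tau (\<gamma> j k))\<^sup>2) * (sigma_max (L_tilde N n m d A B D L k))\<^sup>2
              * vec_norm2 (\<alpha> j) \<le> 0)
     \<longleftrightarrow>
     (\<exists>\<rho> :: nat \<Rightarrow> real.
        (\<forall>j \<le> J. \<forall>k \<le> N.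
           \<beta> j + \<alpha> j \<bullet> mu_hat N n m A B x0 v k
             + tau (\<gamma> j k) * vec_norm2
                 ((mat_sqrt \<Sigma>w * transpose_mat (stacked_input N n d A D)
                    * transpose_mat (1\<^sub>m ((N + 1) * n) + stacked_input N n m A B * L)
                    * transpose_mat (block_extract N n k)) *\<^sub>v \<alpha> j)
             + \<epsilon> * \<rho> k * vec_norm2 (\<alpha> j) * sqrt (1 + (tau (\<gamma> j k))\<^sup>2) \<le> 0)
        \<and> (\<forall>k \<le> N. pos_semidef
             (four_block_mat
               (1\<^sub>m n)
               (block_extract N n k * (1\<^sub>m ((N + 1) * n) + stacked_input N n m A B * L)
                  * stacked_input N n d A D)
               (transpose_mat (stacked_input N n d A D)
                  * transpose_mat (1\<^sub>m ((N + 1) * n) + stacked_input N n m A B * L)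
                  * transpose_mat (block_extract N n k))
               (\<rho> k \<cdot>\<^sub>m 1\<^sub>m (N * d)))))"
proof -
  let ?q = "(N + 1) * n"
  define H where "H = 1\<^sub>m ?q + stacked_input N n m A B * L"
  define DD where "DD = stacked_input N n d A D"
  define E where "E = block_extract N n"
  define M where "M = L_tilde N n m d A B D L"
  have H: "H \<in> carrier_mat ?q ?q"
    unfolding H_def
    by (rule add_carrier_mat, rule mult_carrier_mat[OF stacked_input_carrier admissible_L_carrier])
      (fact assms)
  have DD: "DD \<in> carrier_mat ?q (N * d)" unfolding DD_def by (rule stacked_input_carrier)
  have E: "E k \<in> carrier_mat n ?q" for k unfolding E_def by (rule block_extract_carrier)
  have M_eq: "M k = E k * H * DD" for k
    by (simp only: M_def L_tilde_def E_def H_def DD_def)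
  have EH: "E k * H \<in> carrier_mat n ?q" for k by (rule mult_carrier_mat[OF E H])
  have M: "M k \<in> carrier_mat n (N * d)" for k
    unfolding M_eq by (rule mult_carrier_mat[OF EH DD])
  have Mt: "transpose_mat DD * transpose_mat H * transpose_mat (E k) = transpose_mat (M k)" for k
    unfolding M_eq transpose_mult[OF EH DD] transpose_mult[OF E H]
    by (rule assoc_mult_mat) (use DD H E in auto)
  have psd: "pos_semidef \<Sigma>w" by (rule pos_def_imp_pos_semidef) (fact assms)
  note \<Sigma>w = \<open>\<Sigma>w \<in> carrier_mat (N * d) (N * d)\<close>
  let ?R = "mat_sqrt \<Sigma>w"
  have R: "?R \<in> carrier_mat (N * d) (N * d)" by (rule mat_sqrt_carrier[OF psd \<Sigma>w])
  have norm_eq: "vec_norm2 ((?R * transpose_mat DD * transpose_mat H * transpose_mat (E k)) *\<^sub>v \<alpha> j)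
      = sqrt (\<alpha> j \<bullet> (Sigma_hat N n m d A B D \<Sigma>w L k *\<^sub>v \<alpha> j))" if "j \<le> J" for j k
  proof -
    note a = \<open>\<And>j. j \<le> J \<Longrightarrow> \<alpha> j \<in> carrier_vec n\<close>[OF that]
    define y where "y = transpose_mat (M k) *\<^sub>v \<alpha> j"
    have Mtc: "transpose_mat (M k) \<in> carrier_mat (N * d) n" using M by simp
    have y: "y \<in> carrier_vec (N * d)" unfolding y_def by (rule mult_mat_vec_carrier[OF Mtc a])
    have "?R * transpose_mat DD * transpose_mat H * transpose_mat (E k) = ?R * transpose_mat (M k)"
      unfolding Mt[symmetric] using R DD H E[of k]
      by (simp add: assoc_mult_mat[of _ "N*d" _ _ ?q] assoc_mult_mat[of _ "N*d" _ _ "N*d"]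
        mult_carrier_mat[of _ "N*d" ?q])
    then have "(?R * transpose_mat DD * transpose_mat H * transpose_mat (E k)) *\<^sub>v \<alpha> j = ?R *\<^sub>v y"
      unfolding y_def using assoc_mult_mat_vec[OF R Mtc a] by simp
    moreover have "\<alpha> j \<bullet> (Sigma_hat N n m d A B D \<Sigma>w L k *\<^sub>v \<alpha> j) = y \<bullet> (\<Sigma>w *\<^sub>v y)"
    proof -
      have S: "Sigma_hat N n m d A B D \<Sigma>w L k = M k * \<Sigma>w * transpose_mat (M k)"
        by (simp only: Sigma_hat_def M_def)
      have "(M k * \<Sigma>w * transpose_mat (M k)) *\<^sub>v \<alpha> j = M k *\<^sub>v (\<Sigma>w *\<^sub>v y)"
        unfolding assoc_mult_mat_vec[OF mult_carrier_mat[OF M \<Sigma>w] Mtc a] y_def[symmetric]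
        by (rule assoc_mult_mat_vec[OF M \<Sigma>w y])
      moreover have "\<alpha> j \<bullet> (M k *\<^sub>v (\<Sigma>w *\<^sub>v y)) = y \<bullet> (\<Sigma>w *\<^sub>v y)"
        unfolding y_def
        by (rule transpose_vec_mult_scalar[symmetric, OF M _ a])
          (use \<Sigma>w y y_def in auto)
      ultimately show ?thesis by (simp add: S)
    qed
    ultimately show ?thesis using norm_mat_sqrt_mult[OF psd \<Sigma>w y] by simp
  qed
  have "0 < N * d" using \<open>0 < N\<close> \<open>0 < d\<close> by simp
  then have lmi: "pos_semidef (four_block_mat (1\<^sub>m n) (M k) (transpose_mat (M k)) (r \<cdot>\<^sub>m 1\<^sub>m (N * d)))
      \<longleftrightarrow> (sigma_max (M k))\<^sup>2 \<le> r" for k r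
    using schur_complement_identity_block[OF M] sigma_max_square_le_iff[OF M] by simp
  have mono: "\<epsilon> * sqrt (1 + (tau g)\<^sup>2) * s * vec_norm2 a \<le> \<epsilon> * r * vec_norm2 a * sqrt (1 + (tau g)\<^sup>2)"
    if "s \<le> r" for s r g a
  proof -
    have "0 \<le> \<epsilon> * vec_norm2 a * sqrt (1 + (tau g)\<^sup>2)"
      using \<open>0 < \<epsilon>\<close> by (simp add: vec_norm2_def scalar_prod_self_nonneg)
    from mult_right_mono[OF that this] show ?thesis by (simp add: ac_simps)
  qed
  \<comment> \<open>After this rewriting the matrix inequality reads \<open>(sigma_max (M k))\<^sup>2 \<le> \<rho> k\<close>.\<close>
  show ?thesis
    unfolding DD_def[symmetric] H_def[symmetric] E_def[symmetric] Mt M_eq[symmetric]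
      M_def[symmetric] lmi
  proof (intro iffI)
    assume nonlinear: "\<forall>j \<le> J. \<forall>k \<le> N. \<beta> j + \<alpha> j \<bullet> mu_hat N n m A B x0 v k
          + tau (\<gamma> j k) * sqrt (\<alpha> j \<bullet> (Sigma_hat N n m d A B D \<Sigma>w L k *\<^sub>v \<alpha> j))
          + \<epsilon> * sqrt (1 + (tau (\<gamma> j k))\<^sup>2) * (sigma_max (M k))\<^sup>2 * vec_norm2 (\<alpha> j) \<le> 0"
    show "\<exists>\<rho>. (\<forall>j \<le> J. \<forall>k \<le> N. \<beta> j + \<alpha> j \<bullet> mu_hat N n m A B x0 v k
             + tau (\<gamma> j k) * vec_norm2 ((?R * transpose_mat DD * transpose_mat H
                 * transpose_mat (E k)) *\<^sub>v \<alpha> j)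
             + \<epsilon> * \<rho> k * vec_norm2 (\<alpha> j) * sqrt (1 + (tau (\<gamma> j k))\<^sup>2) \<le> 0)
        \<and> (\<forall>k \<le> N. (sigma_max (M k))\<^sup>2 \<le> \<rho> k)"
      using nonlinear
      by (intro exI[of _ "\<lambda>k. (sigma_max (M k))\<^sup>2"]) (simp add: norm_eq ac_simps)
  next
    assume "\<exists>\<rho>. (\<forall>j \<le> J. \<forall>k \<le> N. \<beta> j + \<alpha> j \<bullet> mu_hat N n m A B x0 v k
             + tau (\<gamma> j k) * vec_norm2 ((?R * transpose_mat DD * transpose_mat H
                 * transpose_mat (E k)) *\<^sub>v \<alpha> j)
             + \<epsilon> * \<rho> k * vec_norm2 (\<alpha> j) * sqrt (1 + (tau (\<gamma> j k))\<^sup>2) \<le> 0)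
        \<and> (\<forall>k \<le> N. (sigma_max (M k))\<^sup>2 \<le> \<rho> k)"
    then obtain \<rho> where linear: "\<And>j k. \<lbrakk>j \<le> J; k \<le> N\<rbrakk> \<Longrightarrow> \<beta> j + \<alpha> j \<bullet> mu_hat N n m A B x0 v k
             + tau (\<gamma> j k) * sqrt (\<alpha> j \<bullet> (Sigma_hat N n m d A B D \<Sigma>w L k *\<^sub>v \<alpha> j))
             + \<epsilon> * \<rho> k * vec_norm2 (\<alpha> j) * sqrt (1 + (tau (\<gamma> j k))\<^sup>2) \<le> 0"
      and le: "\<And>k. k \<le> N \<Longrightarrow> (sigma_max (M k))\<^sup>2 \<le> \<rho> k"
      by (auto simp: norm_eq)
    show "\<forall>j \<le> J. \<forall>k \<le> N. \<beta> j + \<alpha> j \<bullet> mu_hat N n m A B x0 v k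
          + tau (\<gamma> j k) * sqrt (\<alpha> j \<bullet> (Sigma_hat N n m d A B D \<Sigma>w L k *\<^sub>v \<alpha> j))
          + \<epsilon> * sqrt (1 + (tau (\<gamma> j k))\<^sup>2) * (sigma_max (M k))\<^sup>2 * vec_norm2 (\<alpha> j) \<le> 0"
    proof (intro allI impI)
      fix j k assume jk: "j \<le> J" "k \<le> N"
      show "\<beta> j + \<alpha> j \<bullet> mu_hat N n m A B x0 v k
          + tau (\<gamma> j k) * sqrt (\<alpha> j \<bullet> (Sigma_hat N n m d A B D \<Sigma>w L k *\<^sub>v \<alpha> j))
          + \<epsilon> * sqrt (1 + (tau (\<gamma> j k))\<^sup>2) * (sigma_max (M k))\<^sup>2 * vec_norm2 (\<alpha> j) \<le> 0"
        using linear[OF jk] mono[OF le[OF jk(2)], of "\<gamma> j k" "\<alpha> j"] by linarith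
    qed
  qed
qed

end
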